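(* Let $m$ be a positive integer, $q=2^m$, and let $f$ be a uniformly random function from $V_m=\mathbb{F}_2^m$ to $\{\pm1\}$. For every real $\kappa>0$, $$P\Big(\|\widehat f\|_\infty\ge \big(2q(\kappa+\log q)\big)^{1/2}\Big)\le 2e^{-\kappa}.$$
   Context: $\Omega_m$ is the finite set of all functions $f:V_m\to\{\pm1\}$, equipped with the uniform probability $P$ (each $f$ has probability $2^{-q}$). A character $\chi$ of $V_m$ is a group homomorphism $V_m\to\{\pm1\}$; $\widehat V_m$ is the set of characters. The Fourier transform of $f$ is $\widehat f(\chi)=\sum_{x\in V_m}f(x)\chi(x)$, and $\|\widehat f\|_\infty=\max_{\chi\in\widehat V_m}|\widehat f(\chi)|$. $\log$ is the natural logarithm. *)

theory Defs
  imports "HOL-Probability.Probability" "HOL-Library.Z2"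
begin

(* \<open>bit\<close> is the field with two elements, so \<open>bit ^ 'm\<close> is the space V_m for m = CARD('m). *)

lemma UNIV_bit: "(UNIV :: bit set) = {0, 1}"
  using bit_not_one_iff by auto

instance bit :: finite
  by standard (simp add: UNIV_bit)

definition Omega :: "(bit ^ 'm \<Rightarrow> real) set" where
  "Omega = {f. \<forall>x. f x \<in> {1, -1}}"

definition characters :: "(bit ^ 'm \<Rightarrow> real) set" where
  "characters = {\<psi>. (\<forall>x. \<psi> x \<in> {1, -1}) \<and> (\<forall>x y. \<psi> (x + y) = \<psi> x * \<psi> y)}"

definition fourier :: "(bit ^ 'm \<Rightarrow> real) \<Rightarrow> (bit ^ 'm \<Rightarrow> real) \<Rightarrow> real" where
  "fourier f \<psi> = (\<Sum>x\<in>UNIV. f x * \<psi> x)"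

definition fourier_sup_norm :: "(bit ^ 'm \<Rightarrow> real) \<Rightarrow> real" where
  "fourier_sup_norm f = Max ((\<lambda>\<psi>. \<bar>fourier f \<psi>\<bar>) ` characters)"

(* The following facts show that \<open>Max\<close> above and \<open>pmf_of_set Omega\<close> are applied to
   finite nonempty sets, where they have their intended meaning. *)

lemma Omega_eq_PiE: "Omega = (UNIV :: (bit ^ 'm) set) \<rightarrow>\<^sub>E {1, -1}"
  by (auto simp: Omega_def PiE_def Pi_def extensional_def)

lemma finite_Omega: "finite (Omega :: (bit ^ 'm \<Rightarrow> real) set)"
  unfolding Omega_eq_PiE by (intro finite_PiE) auto

lemma Omega_nonempty: "(Omega :: (bit ^ 'm \<Rightarrow> real) set) \<noteq> {}"
  by (auto simp: Omega_def intro!: exI[of _ "\<lambda>_. 1"])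

lemma finite_characters: "finite (characters :: (bit ^ 'm \<Rightarrow> real) set)"
  by (rule finite_subset[OF _ finite_Omega]) (auto simp: characters_def Omega_def)

lemma characters_nonempty: "(characters :: (bit ^ 'm \<Rightarrow> real) set) \<noteq> {}"
  by (auto simp: characters_def intro!: exI[of _ "\<lambda>_. 1"])

lemma pmf_Omega:
  fixes f :: "bit ^ 'm \<Rightarrow> real"
  assumes "f \<in> Omega"
  shows "pmf (pmf_of_set Omega) f = 1 / 2 ^ (2 ^ CARD('m))"
proof -
  have "card (Omega :: (bit ^ 'm \<Rightarrow> real) set) = 2 ^ (2 ^ CARD('m))"
    unfolding Omega_eq_PiE by (subst card_PiE) (auto simp: UNIV_bit numeral_2_eq_2)
  then show ?thesis
    using assms by (simp add: pmf_of_set[OF Omega_nonempty finite_Omega])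
qed

end

theory Submission
  imports Defs "HOL-Probability.Hoeffding"
begin

text \<open>
  For each character the values \<open>f x * \<psi> x\<close> are independent uniform signs, so the exponential
  moment of \<open>fourier f \<psi>\<close> at \<open>t\<close> is \<open>(cosh t)\<close> to the power \<open>q\<close>, hence at most
  \<open>exp (q * t^2 / 2)\<close>. Markov's inequality with \<open>t = s / q\<close> yields the tail bound
  \<open>exp (- s^2 / (2 * q))\<close> for each sign of each of the at most \<open>q\<close> characters.
\<close>

text \<open>Both sides are even in \<open>t\<close>, so \<open>t \<ge> 0\<close> suffices. There the
  logarithmic estimate behind Hoeffding's lemma, taken for a fair coin (\<open>p = 1/2\<close>) on
  an interval of length \<open>2 * t\<close>, gives the bound after factoring out
  \<open>exp (- t)\<close>.\<close>

lemma exp_add_exp_minus_le: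
  fixes t :: real
  shows "exp t + exp (- t) \<le> 2 * exp (t\<^sup>2 / 2)"
proof -
  have nonneg: "exp t + exp (- t) \<le> 2 * exp (t\<^sup>2 / 2)" if "t \<ge> 0" for t :: real
  proof -
    have "- t + ln ((1 + exp (2 * t)) / 2) \<le> t\<^sup>2 / 2"
      using Hoeffdings_lemma_aux[of "2 * t" "1 / 2"] that by (simp add: field_simps power2_eq_square)
    then have le: "exp (- t + ln ((1 + exp (2 * t)) / 2)) \<le> exp (t\<^sup>2 / 2)"
      by simp
    have "exp t + exp (- t) = 2 * (exp (- t) * ((1 + exp (2 * t)) / 2))"
      by (simp add: distrib_left flip: exp_add)
    also have "\<dots> = 2 * exp (- t + ln ((1 + exp (2 * t)) / 2))"
      by (subst exp_add) (simp add: add_pos_pos)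
    also have "\<dots> \<le> 2 * exp (t\<^sup>2 / 2)"
      using le by (rule mult_left_mono) simp
    finally show ?thesis .
  qed
  show ?thesis
    using nonneg[of t] nonneg[of "- t"] by (cases "t \<ge> 0") (auto simp: add.commute)
qed

text \<open>The exponential of the sum is a product over points, and summing such a product over all
  sign functions factorises into one two-term sum per point. As \<open>\<psi> x\<close> is a sign,
  each of these is \<open>exp t + exp (- t)\<close>.\<close>

lemma sum_exp_fourier_le:
  fixes \<psi> :: "bit ^ 'm::finite \<Rightarrow> real"
  assumes "\<And>x. \<psi> x \<in> {1, - 1}"
  shows "(\<Sum>f\<in>Omega. exp (t * fourier f \<psi>)) \<le> (2 * exp (t\<^sup>2 / 2)) ^ CARD(bit ^ 'm)"
proof -
  have "(\<Sum>f\<in>Omega. exp (t * fourier f \<psi>))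
      = (\<Sum>f\<in>UNIV \<rightarrow>\<^sub>E {1, - 1}. \<Prod>x\<in>UNIV. exp (t * (f x * \<psi> x)))"
    by (simp add: Omega_eq_PiE fourier_def sum_distrib_left exp_sum)
  also have "\<dots> = (\<Prod>x\<in>UNIV. \<Sum>y\<in>{1, - 1}. exp (t * (y * \<psi> x)))"
    by (rule prod_sum_PiE[symmetric]) auto
  also have "\<dots> \<le> (\<Prod>x\<in>(UNIV :: (bit ^ 'm) set). 2 * exp (t\<^sup>2 / 2))"
  proof (rule prod_mono)
    fix x :: "bit ^ 'm"
    show "0 \<le> (\<Sum>y\<in>{1, - 1}. exp (t * (y * \<psi> x))) \<and>
        (\<Sum>y\<in>{1, - 1}. exp (t * (y * \<psi> x))) \<le> 2 * exp (t\<^sup>2 / 2)"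
      using assms[of x] exp_add_exp_minus_le[of t] by (auto simp: sum_nonneg)
  qed
  finally show ?thesis
    by simp
qed

text \<open>Stated for sign-valued \<open>\<psi>\<close> so that it also covers the negative of a
  character, which is not a character itself but supplies the lower tail.\<close>

lemma prob_fourier_ge_le:
  fixes \<psi> :: "bit ^ 'm::finite \<Rightarrow> real" and s :: real
  assumes "\<And>x. \<psi> x \<in> {1, - 1}" and "s > 0"
  shows "measure_pmf.prob (pmf_of_set Omega) {f. fourier f \<psi> \<ge> s}
    \<le> exp (- s\<^sup>2 / (2 * real CARD(bit ^ 'm)))"
proof -
  define n where "n = CARD(bit ^ 'm)"
  \<comment> \<open>This value minimises the Chernoff exponent
    \<open>- t * s + n * t^2 / 2\<close>.\<close>
  define t where "t = s / n"
  have n: "n > 0"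
    by (simp add: n_def)
  have card: "card (Omega :: (bit ^ 'm \<Rightarrow> real) set) = 2 ^ n"
    unfolding Omega_eq_PiE n_def by (subst card_funcsetE) (auto simp: numeral_2_eq_2)
  let ?M = "measure_pmf (pmf_of_set (Omega :: (bit ^ 'm \<Rightarrow> real) set))"
  have int: "integrable ?M g" for g :: "_ \<Rightarrow> real"
    by (intro integrable_measure_pmf_finite) (simp add: finite_Omega Omega_nonempty)
  have "measure_pmf.prob (pmf_of_set Omega) {f. fourier f \<psi> \<ge> s}
      \<le> exp (- t * s) * measure_pmf.expectation (pmf_of_set Omega) (\<lambda>f. exp (t * fourier f \<psi>))"
    using measure_pmf.Chernoff_ineq_ge[of t "pmf_of_set Omega" UNIV "\<lambda>f. fourier f \<psi>" s] n assms(2) int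
    by (simp add: t_def set_integrable_def set_lebesgue_integral_def)
  also have "\<dots> \<le> exp (- t * s) * ((2 * exp (t\<^sup>2 / 2)) ^ n / 2 ^ n)"
  proof (rule mult_left_mono)
    show "measure_pmf.expectation (pmf_of_set Omega) (\<lambda>f. exp (t * fourier f \<psi>))
        \<le> (2 * exp (t\<^sup>2 / 2)) ^ n / 2 ^ n"
      unfolding integral_pmf_of_set[OF Omega_nonempty finite_Omega] card n_def
      by (simp only: of_nat_power of_nat_numeral)
        (intro divide_right_mono sum_exp_fourier_le assms(1), simp)
  qed simp
  also have "\<dots> = exp (- t * s + n * (t\<^sup>2 / 2))"
    by (simp only: exp_add exp_of_nat_mult power_mult_distrib) simp
  also have "- t * s + n * (t\<^sup>2 / 2) = - s\<^sup>2 / (2 * n)"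
    using n by (simp add: t_def field_simps power2_eq_square)
  finally show ?thesis
    by (simp add: n_def)
qed

text \<open>A character is determined by its values on the standard basis.\<close>

lemma card_characters_le:
  "card (characters :: (bit ^ 'm::finite \<Rightarrow> real) set) \<le> 2 ^ CARD('m)"
proof -
  let ?r = "\<lambda>\<psi> :: bit ^ 'm \<Rightarrow> real. \<lambda>i. \<psi> (axis i 1)"
  have expand: "\<psi> x = (\<Prod>i\<in>UNIV. if x $ i = 1 then \<psi> (axis i 1) else 1)"
    if \<psi>: "\<psi> \<in> characters" for \<psi> and x :: "bit ^ 'm"
  proof -
    \<comment> \<open>A sign equal to its own square is 1. This settles the empty sum below and the
      coordinates of \<open>x\<close> that vanish.\<close>
    have "\<psi> (0 + 0) = \<psi> 0 * \<psi> 0" "\<psi> 0 \<in> {1, - 1}"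
      using \<psi> by (simp_all only: characters_def mem_Collect_eq)
    then have zero: "\<psi> 0 = 1"
      by auto
    have sum: "\<psi> (\<Sum>i\<in>A. g i) = (\<Prod>i\<in>A. \<psi> (g i))" if "finite A" for g and A :: "'m set"
      using that by (induction A) (use \<psi> zero in \<open>auto simp: characters_def\<close>)
    have "\<psi> x = \<psi> (\<Sum>i\<in>UNIV. (x $ i) *s axis i 1)"
      by (simp add: basis_expansion)
    also have "\<dots> = (\<Prod>i\<in>UNIV. \<psi> ((x $ i) *s axis i 1))"
      by (rule sum) simp
    also have "\<dots> = (\<Prod>i\<in>UNIV. if x $ i = 1 then \<psi> (axis i 1) else 1)"
      by (rule prod.cong) (auto simp: zero)
    finally show ?thesis .
  qed
  have "inj_on ?r characters"
  proof (rule inj_onI, rule ext)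
    fix \<psi> \<psi>' :: "bit ^ 'm \<Rightarrow> real" and x
    assume \<psi>: "\<psi> \<in> characters" "\<psi>' \<in> characters" and eq: "?r \<psi> = ?r \<psi>'"
    from eq have "\<psi> (axis i 1) = \<psi>' (axis i 1)" for i
      by (rule fun_cong)
    then show "\<psi> x = \<psi>' x"
      by (simp add: \<psi>[THEN expand, of x] cong: if_cong)
  qed
  moreover have "?r ` characters \<subseteq> (UNIV :: 'm set) \<rightarrow>\<^sub>E {1, - 1}"
    by (auto simp: characters_def)
  ultimately have "card (characters :: (bit ^ 'm \<Rightarrow> real) set)
      \<le> card ((UNIV :: 'm set) \<rightarrow>\<^sub>E {1, - 1 :: real})"
    by (intro card_inj_on_le finite_PiE) auto
  also have "\<dots> = 2 ^ CARD('m)"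
    by (subst card_funcsetE) (auto simp: numeral_2_eq_2)
  finally show ?thesis .
qed

theorem mainTheorem1:
  fixes m :: nat and q \<kappa> :: real
  assumes "m = CARD('m::finite)"
    and "q = 2 ^ m"
    and "\<kappa> > 0"
  shows "measure_pmf.prob (pmf_of_set (Omega :: (bit ^ 'm \<Rightarrow> real) set))
           {f. fourier_sup_norm f \<ge> sqrt (2 * q * (\<kappa> + ln q))} \<le> 2 * exp (- \<kappa>)"
proof -
  define s where "s = sqrt (2 * q * (\<kappa> + ln q))"
  let ?P = "measure_pmf.prob (pmf_of_set (Omega :: (bit ^ 'm \<Rightarrow> real) set))"
  let ?C = "characters :: (bit ^ 'm \<Rightarrow> real) set"
  have q: "q \<ge> 1" "real CARD(bit ^ 'm) = q"
    using assms by (simp_all add: UNIV_bit numeral_2_eq_2)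
  have pos: "\<kappa> + ln q > 0"
    using q assms(3) by (simp add: add_pos_nonneg)
  have s: "s > 0" "s\<^sup>2 = 2 * q * (\<kappa> + ln q)"
    using q pos by (simp_all add: s_def)
  \<comment> \<open>The term \<open>ln q\<close> in the threshold produces a factor
    \<open>1 / q\<close> in each tail, which will absorb the number of characters in the union
    bound.\<close>
  have "- s\<^sup>2 / (2 * q) = - \<kappa> - ln q"
    using q by (simp add: s(2) field_simps)
  then have exp_s: "exp (- s\<^sup>2 / (2 * q)) = exp (- \<kappa>) / q"
    using q by (simp add: exp_diff)
  have one: "?P {f. \<bar>fourier f \<psi>\<bar> \<ge> s} \<le> 2 * (exp (- \<kappa>) / q)" if "\<psi> \<in> ?C" for \<psi>
  proof -
    have \<psi>: "\<psi> x \<in> {1, - 1}" "- \<psi> x \<in> {1, - 1}" for x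
      using that by (auto simp: characters_def minus_equation_iff)
    \<comment> \<open>Negating \<open>\<psi>\<close> negates the transform, so the lower tail for
      \<open>\<psi>\<close> is an upper tail for its negative.\<close>
    have "{f. \<bar>fourier f \<psi>\<bar> \<ge> s} = {f. fourier f \<psi> \<ge> s} \<union> {f. fourier f (\<lambda>x. - \<psi> x) \<ge> s}"
      by (auto simp: fourier_def sum_negf)
    then have "?P {f. \<bar>fourier f \<psi>\<bar> \<ge> s}
        \<le> ?P {f. fourier f \<psi> \<ge> s} + ?P {f. fourier f (\<lambda>x. - \<psi> x) \<ge> s}"
      by (simp add: measure_Un_le)
    also have "\<dots> \<le> exp (- \<kappa>) / q + exp (- \<kappa>) / q"
      using prob_fourier_ge_le[of \<psi> s] prob_fourier_ge_le[of "\<lambda>x. - \<psi> x" s] \<psi> s(1) exp_s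
      unfolding q(2) by (intro add_mono) auto
    finally show ?thesis
      by simp
  qed
  \<comment> \<open>A maximum over a finite nonempty set reaches \<open>s\<close> exactly when some
    member does, which prepares the union bound.\<close>
  have "{f. fourier_sup_norm f \<ge> s} = (\<Union>\<psi>\<in>?C. {f. \<bar>fourier f \<psi>\<bar> \<ge> s})"
    by (auto simp: fourier_sup_norm_def Max_ge_iff finite_characters characters_nonempty)
  then have "?P {f. fourier_sup_norm f \<ge> s} \<le> (\<Sum>\<psi>\<in>?C. ?P {f. \<bar>fourier f \<psi>\<bar> \<ge> s})"
    using measure_pmf.finite_measure_subadditive_finite[OF finite_characters] by simp
  also have "\<dots> \<le> card ?C * (2 * (exp (- \<kappa>) / q))"
    by (intro sum_bounded_above one)
  also have "\<dots> \<le> q * (2 * (exp (- \<kappa>) / q))"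
  proof (intro mult_right_mono)
    show "real (card ?C) \<le> q"
      using card_characters_le[where 'm = 'm] assms(1,2)
      by (metis of_nat_le_iff of_nat_numeral of_nat_power)
  qed (use q in simp)
  also have "\<dots> = 2 * exp (- \<kappa>)"
    using q by simp
  finally show ?thesis
    by (simp add: s_def)
qed

end
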